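(* Let $d,k\geq 2$ be arbitrary but fixed positive integers. Then $$\liminf_{\substack{|T|\to \infty \\ T\ d\text{-ary tree}}} \gamma(F^2_k,T) =\liminf_{\substack{|T|\to \infty \\ T\ \text{strictly } d\text{-ary tree}}} \gamma(F^2_k,T)=\frac{k!}{2} \cdot (d-1)^{k-1} \cdot \prod_{j=1}^{k-1}(d^j-1)^{-1}.$$ Furthermore, for every $n\geq k$, $$\min_{\substack{|T|=n\\ T\ d\text{-ary tree}}} \gamma\big(F^2_k,T \big) \leq \liminf_{\substack{|T|\to \infty \\ T\ d\text{-ary tree}}} \gamma(F^2_k,T).$$
   Context: All trees are finite rooted (unordered) trees, considered up to isomorphism of rooted trees. For an integer $d\ge 2$, a $d$-ary tree is a rooted tree in which each non-leaf vertex has outdegree (number of children) at least $2$ and at most $d$; the single vertex is the tree with one leaf. A strictly $d$-ary tree is a $d$-ary tree in which every vertex has outdegree $0$ or $d$. A binary tree is a $d$-ary tree with $d=2$. $|T|$ denotes the number of leaves of $T$. Given a nonempty set $L$ of leaves of $T$, the tree induced by $L$ (a leaf-induced subtree) is obtained by taking the minimal subtree of $T$ containing all leaves in $L$ (rooted at its vertex closest to the root of $T$) and then erasing (suppressing) all vertices of outdegree $1$. For $d$-ary trees $D$ and $T$, $c(D,T)$ denotes the number of $|D|$-element subsets of leaves of $T$ that induce a tree isomorphic to $D$, and the density of $D$ in $T$ is $\gamma(D,T)=c(D,T)/\binom{|T|}{|D|}$ (for $|T|\ge |D|$). The binary caterpillar $F^2_k$ is the binary tree with $k$ leaves whose non-leaf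 vertices form a path starting at the root. The notation $\liminf_{|T|\to\infty}$ over a class of trees means $\lim_{N\to\infty}\inf\{\gamma(F^2_k,T): T \text{ in the class}, |T|\ge N\}$. *)

theory Defs
  imports Complex_Main
begin

text \<open>
  A finite rooted tree is represented by an ordered tree; the order of the children is
  immaterial, as trees are only ever compared by \<open>tree_iso\<close>.  The tree with one vertex is
  \<open>Node []\<close>.
\<close>

datatype tree = Node "tree list"

inductive tree_iso :: "tree \<Rightarrow> tree \<Rightarrow> bool" where
  "bij_betw f {..<length ts} {..<length us} \<Longrightarrow>
   (\<And>i. i < length ts \<Longrightarrow> tree_iso (ts ! i) (us ! f i)) \<Longrightarrow>
   tree_iso (Node ts) (Node us)"

lemma size_nth_tree [termination_simp]:
  "i < length ts \<Longrightarrow> size (ts ! i) < Suc (size_list size ts)"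
  by (meson le_imp_less_Suc nth_mem order_refl size_list_estimation')

text \<open>
  A vertex is addressed by the list of child indices that leads to it from the root.
\<close>

fun leaves :: "tree \<Rightarrow> nat list set" where
  "leaves (Node ts) =
     (if ts = [] then {[]} else (\<Union>i<length ts. (#) i ` leaves (ts ! i)))"

definition leaf_count :: "tree \<Rightarrow> nat" where
  "leaf_count T = card (leaves T)"

fun outdegrees :: "tree \<Rightarrow> nat set" where
  "outdegrees (Node ts) = insert (length ts) (\<Union>t\<in>set ts. outdegrees t)"

definition d_ary :: "nat \<Rightarrow> tree \<Rightarrow> bool" where
  "d_ary d T \<longleftrightarrow> (\<forall>m\<in>outdegrees T. m \<noteq> 0 \<longrightarrow> 2 \<le> m \<and> m \<le> d)"

definition strictly_d_ary :: "nat \<Rightarrow> tree \<Rightarrow> bool" where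
  "strictly_d_ary d T \<longleftrightarrow> d_ary d T \<and> (\<forall>m\<in>outdegrees T. m = 0 \<or> m = d)"

text \<open>
  \<open>spanned L T\<close> is the union of the paths from the root of \<open>T\<close> to the leaves in \<open>L\<close>
  (for nonempty \<open>L \<subseteq> leaves T\<close>).  It is the minimal subtree of \<open>T\<close> containing \<open>L\<close> together
  with the path joining the root of \<open>T\<close> to the root of that subtree.  The additional vertices
  all have outdegree 1, so \<open>suppress\<close> erases them along with the other vertices
  of outdegree 1.
\<close>

function spanned :: "nat list set \<Rightarrow> tree \<Rightarrow> tree" where
  "spanned L (Node ts) =
     Node (map (\<lambda>i. spanned {p. i # p \<in> L} (ts ! i))
               (filter (\<lambda>i. \<exists>p. i # p \<in> L) [0..<length ts]))"
  by pat_completeness auto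
termination
  by (relation "measure (\<lambda>(L, T). size T)")
     (auto simp: size_nth_tree)

fun suppress :: "tree \<Rightarrow> tree" where
  "suppress (Node [t]) = suppress t"
| "suppress (Node ts) = Node (map suppress ts)"

definition induced_subtree :: "nat list set \<Rightarrow> tree \<Rightarrow> tree" where
  "induced_subtree L T = suppress (spanned L T)"

definition copies :: "tree \<Rightarrow> tree \<Rightarrow> nat" where
  "copies D T =
     card {L. L \<subseteq> leaves T \<and> card L = leaf_count D \<and> tree_iso (induced_subtree L T) D}"

definition density :: "tree \<Rightarrow> tree \<Rightarrow> real" where
  "density D T = real (copies D T) / real (leaf_count T choose leaf_count D)"

text \<open>
  The binary caterpillar with \<open>k\<close> leaves, for \<open>k \<ge> 1\<close>; the value at 0 is a dummy.
\<close>

fun caterpillar :: "nat \<Rightarrow> tree" where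
  "caterpillar 0 = Node []"
| "caterpillar (Suc 0) = Node []"
| "caterpillar (Suc (Suc n)) = Node [Node [], caterpillar (Suc n)]"

definition tail_inf :: "tree set \<Rightarrow> tree \<Rightarrow> nat \<Rightarrow> real" where
  "tail_inf C D N = (INF T\<in>{T\<in>C. N \<le> leaf_count T}. density D T)"

text \<open>
  The limit exists whenever \<open>C\<close> contains trees with arbitrarily many leaves; see
  \<open>tail_inf_LIMSEQ\<close> below.
\<close>

definition liminf_density :: "tree set \<Rightarrow> tree \<Rightarrow> real" where
  "liminf_density C D = lim (tail_inf C D)"


lemma finite_leaves: "finite (leaves T)"
  by (induction T rule: leaves.induct) auto

lemma leaf_count_Leaf: "leaf_count (Node []) = 1"
  by (simp add: leaf_count_def)

lemma leaf_count_Node: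
  assumes "ts \<noteq> []"
  shows "leaf_count (Node ts) = (\<Sum>t\<leftarrow>ts. leaf_count t)"
proof -
  have "leaf_count (Node ts) = card (\<Union>i<length ts. (#) i ` leaves (ts ! i))"
    using assms by (simp add: leaf_count_def)
  also have "\<dots> = (\<Sum>i<length ts. card ((#) i ` leaves (ts ! i)))"
    by (rule card_UN_disjoint) (auto simp: finite_leaves)
  also have "\<dots> = (\<Sum>i<length ts. leaf_count (ts ! i))"
    by (simp add: card_image leaf_count_def)
  also have "\<dots> = (\<Sum>t\<leftarrow>ts. leaf_count t)"
    by (simp add: sum_list_sum_nth atLeast0LessThan)
  finally show ?thesis .
qed

lemma leaf_count_caterpillar: "k \<ge> 1 \<Longrightarrow> leaf_count (caterpillar k) = k"
  by (induction k rule: caterpillar.induct) (auto simp: leaf_count_Leaf leaf_count_Node)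

lemma density_nonneg: "density D T \<ge> 0"
  by (simp add: density_def)

lemma copies_le: "copies D T \<le> leaf_count T choose leaf_count D"
proof -
  have "copies D T \<le> card {L. L \<subseteq> leaves T \<and> card L = leaf_count D}"
    unfolding copies_def by (intro card_mono) (auto simp: finite_leaves)
  also have "\<dots> = leaf_count T choose leaf_count D"
    by (simp add: n_subsets finite_leaves leaf_count_def)
  finally show ?thesis .
qed

lemma density_le_1: "density D T \<le> 1"
  using copies_le[of D T] by (auto simp: density_def divide_le_eq_1)

lemma finite_densities: "finite (density D ` {T. P T \<and> leaf_count T = n})"
proof (rule finite_subset)
  show "density D ` {T. P T \<and> leaf_count T = n}
          \<subseteq> (\<lambda>c. real c / real (n choose leaf_count D)) ` {..n choose leaf_count D}"
    using copies_le by (auto simp: density_def)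
qed simp

lemma d_ary_caterpillar: "d \<ge> 2 \<Longrightarrow> d_ary d (caterpillar k)"
  by (induction k rule: caterpillar.induct) (auto simp: d_ary_def)

lemma tail_inf_LIMSEQ:
  assumes unbounded: "\<And>N. \<exists>T\<in>C. N \<le> leaf_count T"
  shows "tail_inf C D \<longlonglongrightarrow> liminf_density C D"
proof -
  have bdd: "bdd_below (density D ` A)" for A
    by (rule bdd_belowI2[of _ 0]) (rule density_nonneg)
  have "incseq (tail_inf C D)"
    unfolding tail_inf_def
  proof (rule incseq_SucI, rule cINF_superset_mono)
    fix n show "{T \<in> C. Suc n \<le> leaf_count T} \<noteq> {}" using unbounded by blast
  qed (auto simp: bdd)
  moreover have "tail_inf C D N \<le> 1" for N
  proof -
    obtain T where "T \<in> C" "N \<le> leaf_count T" using unbounded by blast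
    hence "tail_inf C D N \<le> density D T"
      unfolding tail_inf_def by (intro cINF_lower bdd) auto
    also note density_le_1
    finally show ?thesis .
  qed
  ultimately have "convergent (tail_inf C D)"
    by (metis convergentI incseq_convergent)
  thus ?thesis
    by (simp add: liminf_density_def convergent_LIMSEQ_iff)
qed

lemma strictly_d_ary_unbounded:
  assumes "d \<ge> 2"
  shows "\<exists>T. strictly_d_ary d T \<and> N \<le> leaf_count T"
proof (induction N)
  case 0
  have "strictly_d_ary d (Node [])" by (simp add: strictly_d_ary_def d_ary_def)
  thus ?case by blast
next
  case (Suc N)
  then obtain T where T: "strictly_d_ary d T" "N \<le> leaf_count T" by blast
  let ?S = "Node (T # replicate (d - 1) (Node []))"
  have "strictly_d_ary d ?S"
    using T(1) assms by (auto simp: strictly_d_ary_def d_ary_def split: if_splits)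
  moreover have "leaf_count ?S = leaf_count T + (d - 1)"
    by (simp add: leaf_count_Node leaf_count_Leaf sum_list_replicate)
  ultimately show ?case
    using T(2) assms by (intro exI[of _ ?S]) auto
qed

end

theory Submission
  imports Defs
begin

text \<open>
  Write \<open>c\<^sub>k\<close> for the number of copies of the caterpillar with \<open>k\<close> leaves.  Splitting the
  copies at the root of a tree with \<open>n\<close> leaves and branches \<open>t\<close> having \<open>x\<^sub>t\<close> leaves gives,
  for \<open>k \<ge> 2\<close>, the recursion that \<open>c\<^sub>k\<^sub>+\<^sub>1\<close> is the sum of \<open>c\<^sub>k\<^sub>+\<^sub>1(t) + (n - x\<^sub>t) c\<^sub>k(t)\<close>
  over \<open>t\<close>.  With \<open>\<alpha>\<^sub>k\<close> the claimed limit divided by \<open>k!\<close>, it yields the bound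
  \<open>c\<^sub>k(T) \<ge> \<alpha>\<^sub>k n^k - n^(k - 1) / 2\<close> for every \<open>d\<close>-ary tree by induction, and
  \<open>c\<^sub>k(T) \<le> \<alpha>\<^sub>k n^k\<close> for the complete \<open>d\<close>-ary trees, where all branches are equal.
  The lower bound rests on the fact that for nonnegative reals \<open>x\<^sub>1, \<dots>, x\<^sub>d\<close> with sum \<open>n\<close> the
  quantity \<open>(d / n)^m * (\<Sum>i. x\<^sub>i^m (n - x\<^sub>i))\<close> increases with \<open>m \<ge> 1\<close>.
  Finally, the density in a tree is the average of the densities in the trees obtained by
  deleting one leaf, so the minimum density over trees with \<open>n\<close> leaves is nondecreasing in \<open>n\<close>.
\<close>

section \<open>A recursion for the number of caterpillars\<close>

definition branch :: "nat list set \<Rightarrow> nat \<Rightarrow> nat list set" where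
  "branch L i = {p. i # p \<in> L}"

text \<open>An increasing list rather than a set, so that it is the very index list that
  \<open>spanned\<close> keeps at the root.\<close>

definition branches :: "nat list set \<Rightarrow> tree list \<Rightarrow> nat list" where
  "branches L ts = filter (\<lambda>i. branch L i \<noteq> {}) [0..<length ts]"

definition copy_sets :: "tree \<Rightarrow> tree \<Rightarrow> nat list set set" where
  "copy_sets D T = {L. L \<subseteq> leaves T \<and> card L = leaf_count D \<and> tree_iso (induced_subtree L T) D}"

lemma copies_eq_card: "copies D T = card (copy_sets D T)"
  by (simp add: copies_def copy_sets_def)

lemma finite_copy_sets: "finite (copy_sets D T)"
  by (rule finite_subset[of _ "Pow (leaves T)"]) (auto simp: copy_sets_def finite_leaves)

lemma branch_subset: "L \<subseteq> leaves (Node ts) \<Longrightarrow> branch L i \<subseteq> leaves (ts ! i)"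
  by (auto simp: branch_def split: if_splits)

lemma finite_branch: "finite L \<Longrightarrow> finite (branch L i)"
  using finite_vimageI[of L "(#) i"] by (simp add: branch_def vimage_def)

lemma branch_Cons_image [simp]: "branch ((#) i ` M) j = (if j = i then M else {})"
  by (auto simp: branch_def)

lemma branch_insert_Cons [simp]:
  "branch (insert (i # p) L) j = (if j = i then insert p (branch L j) else branch L j)"
  by (auto simp: branch_def)

lemma set_branches: "set (branches L ts) = {i. i < length ts \<and> branch L i \<noteq> {}}"
  by (auto simp: branches_def)

lemma branches_eqI:
  assumes "sorted xs" "distinct xs" "set xs = {i. i < length ts \<and> branch L i \<noteq> {}}"
  shows "branches L ts = xs"
proof (rule sorted_distinct_set_unique)
  show "sorted (branches L ts)" "distinct (branches L ts)"
    by (simp_all add: branches_def sorted_wrt_filter)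
  show "set (branches L ts) = set xs" using assms(3) by (simp add: set_branches)
qed (use assms in auto)

lemma union_branches:
  assumes "L \<subseteq> leaves (Node ts)" "ts \<noteq> []"
  shows "L = (\<Union>i\<in>set (branches L ts). (#) i ` branch L i)"
  using assms by (auto simp: set_branches branch_def) blast

lemma card_union_branches:
  assumes "L \<subseteq> leaves (Node ts)" "ts \<noteq> []"
  shows "card L = (\<Sum>i\<in>set (branches L ts). card (branch L i))"
proof -
  have fin: "finite L" using assms finite_leaves finite_subset by metis
  have "card (\<Union>i\<in>set (branches L ts). (#) i ` branch L i) =
          (\<Sum>i\<in>set (branches L ts). card ((#) i ` branch L i))"
    by (rule card_UN_disjoint) (auto simp: finite_branch fin)
  thus ?thesis using union_branches[OF assms] by (simp add: card_image)
qed

lemma spanned_Node: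
  "spanned L (Node ts) = Node (map (\<lambda>i. spanned (branch L i) (ts ! i)) (branches L ts))"
  by (auto simp: branch_def branches_def)

lemma induced_subtree_single:
  "branches L ts = [i] \<Longrightarrow> induced_subtree L (Node ts) = induced_subtree (branch L i) (ts ! i)"
  by (simp add: induced_subtree_def spanned_Node del: spanned.simps)

text \<open>Only a root with exactly one remaining child is erased by \<open>suppress\<close>, so
  here the root survives and suppression acts inside the branches.\<close>

lemma induced_subtree_several:
  assumes "length (branches L ts) \<noteq> 1"
  shows "induced_subtree L (Node ts) =
           Node (map (\<lambda>i. induced_subtree (branch L i) (ts ! i)) (branches L ts))"
proof -
  have *: "suppress (Node us) = Node (map suppress us)" if "length us \<noteq> 1" for us
    using that by (cases "Node us" rule: suppress.cases) auto
  show ?thesis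
    unfolding induced_subtree_def spanned_Node by (subst *) (use assms in auto)
qed

section \<open>Isomorphism with the leaf and with two-branch trees\<close>

lemma tree_iso_Leaf_iff [simp]: "tree_iso t (Node []) \<longleftrightarrow> t = Node []"
  by (subst tree_iso.simps) (auto simp: bij_betw_def)

text \<open>A bijection between two-element index sets is the identity or the swap, which gives the
  two ways of matching the branches.\<close>

lemma tree_iso_Node2_iff:
  "tree_iso (Node us) (Node [a, b]) \<longleftrightarrow>
     (\<exists>x y. us = [x, y] \<and> (tree_iso x a \<and> tree_iso y b \<or> tree_iso x b \<and> tree_iso y a))"
proof
  assume "tree_iso (Node us) (Node [a, b])"
  then obtain f where f: "bij_betw f {..<length us} {..<2}"
    "\<And>i. i < length us \<Longrightarrow> tree_iso (us ! i) ([a, b] ! f i)"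
    by (subst (asm) tree_iso.simps) (auto simp: numeral_2_eq_2)
  have "length us = 2" using bij_betw_same_card[OF f(1)] by simp
  then obtain x y where us: "us = [x, y]"
    by (auto simp: numeral_2_eq_2 length_Suc_conv)
  have "f 0 < 2" "f 1 < 2" "f 0 \<noteq> f 1"
    using f(1) us by (auto simp: bij_betw_def inj_on_def)
  hence "f 0 = 0 \<and> f 1 = 1 \<or> f 0 = 1 \<and> f 1 = 0" by linarith
  thus "\<exists>x y. us = [x, y] \<and> (tree_iso x a \<and> tree_iso y b \<or> tree_iso x b \<and> tree_iso y a)"
    using f(2)[of 0] f(2)[of 1] us by auto
next
  assume "\<exists>x y. us = [x, y] \<and> (tree_iso x a \<and> tree_iso y b \<or> tree_iso x b \<and> tree_iso y a)"
  then obtain x y where us: "us = [x, y]"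
    and "tree_iso x a \<and> tree_iso y b \<or> tree_iso x b \<and> tree_iso y a" by blast
  thus "tree_iso (Node us) (Node [a, b])"
  proof (elim disjE)
    assume "tree_iso x a \<and> tree_iso y b"
    thus ?thesis unfolding us
      by (intro tree_iso.intros[of id]) (auto simp: nth_Cons')
  next
    assume "tree_iso x b \<and> tree_iso y a"
    moreover have "bij_betw (\<lambda>i. 1 - i) {..<length [x, y]} {..<length [a, b]}"
      by (rule bij_betw_byWitness[where f' = "\<lambda>i. 1 - i"]) auto
    ultimately show ?thesis unfolding us
      by (intro tree_iso.intros[of "\<lambda>i. 1 - i"]) (auto simp: nth_Cons')
  qed
qed

lemma length_branches_pos:
  assumes "L \<subseteq> leaves (Node ts)" "L \<noteq> {}" "ts \<noteq> []"
  shows "branches L ts \<noteq> []"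
  using union_branches[of L ts] assms by auto

text \<open>Induction on \<open>T\<close>: one branch met means passing to that branch, while two or
  more mean at least two leaves and a root that keeps its children.\<close>

lemma induced_subtree_Leaf_iff:
  assumes "L \<subseteq> leaves T" "L \<noteq> {}"
  shows "induced_subtree L T = Node [] \<longleftrightarrow> card L = 1"
  using assms
proof (induction T arbitrary: L)
  case (Node ts)
  show ?case
  proof (cases "ts = []")
    case True
    with Node.prems have "L = {[]}" by auto
    thus ?thesis using True by (simp add: induced_subtree_def)
  next
    case False
    have ne: "branches L ts \<noteq> []" using length_branches_pos Node.prems False by blast
    have card: "card L = (\<Sum>i\<in>set (branches L ts). card (branch L i))"
      using card_union_branches Node.prems False by blast
    show ?thesis
    proof (cases "length (branches L ts) = 1")
      case True
      then obtain i where i: "branches L ts = [i]" by (auto simp: length_Suc_conv)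
      hence "i \<in> set (branches L ts)" by simp
      hence "i < length ts" "branch L i \<noteq> {}" by (auto simp: set_branches)
      thus ?thesis
        using Node.IH[of "ts ! i" "branch L i"] branch_subset[OF Node.prems(1)] card i
        by (simp add: induced_subtree_single)
    next
      case 2: False
      have fin: "finite L" using Node.prems finite_leaves finite_subset by metis
      have "distinct (branches L ts)" by (simp add: branches_def)
      hence "card (set (branches L ts)) \<ge> 2"
        using 2 ne by (simp add: distinct_card) (cases "branches L ts"; auto simp: Suc_le_eq)
      also have "card (set (branches L ts)) = (\<Sum>i\<in>set (branches L ts). 1)" by simp
      also have "\<dots> \<le> card L" unfolding card
        by (rule sum_mono) (auto simp: set_branches Suc_le_eq card_gt_0_iff finite_branch fin)
      finally show ?thesis using ne by (simp add: induced_subtree_several[OF 2])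
    qed
  qed
qed

text \<open>Two leaves are followed down while one branch contains both; where they separate, each
  branch holds one leaf and the cherry appears. This starts the induction on \<open>k\<close> at
  2.\<close>

lemma copy_sets_cherry: "copy_sets (caterpillar 2) T = {L. L \<subseteq> leaves T \<and> card L = 2}"
proof -
  have "tree_iso (induced_subtree L T) (caterpillar 2)" if "L \<subseteq> leaves T" "card L = 2" for L
    using that
  proof (induction T arbitrary: L)
    case (Node ts)
    have fin: "finite L" and ne: "L \<noteq> {}" using Node.prems(2) by (auto intro: card_ge_0_finite)
    show ?case
    proof (cases "ts = []")
      case True
      with Node.prems have "card L \<le> card {[] :: nat list}" by (intro card_mono) auto
      thus ?thesis using Node.prems by simp
    next
      case False
      have bne: "branches L ts \<noteq> []" using length_branches_pos Node.prems ne False by blast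
      have card: "(\<Sum>i\<in>set (branches L ts). card (branch L i)) = 2"
        using card_union_branches Node.prems False by metis
      show ?thesis
      proof (cases "length (branches L ts) = 1")
        case True
        then obtain i where i: "branches L ts = [i]" by (auto simp: length_Suc_conv)
        hence "i \<in> set (branches L ts)" by simp
        hence "i < length ts" "branch L i \<noteq> {}" by (auto simp: set_branches)
        thus ?thesis
          using Node.IH[of "ts ! i" "branch L i"] branch_subset[OF Node.prems(1)] card i
          by (simp add: induced_subtree_single)
      next
        case 2: False
        then obtain i j r where ij: "branches L ts = i # j # r"
          using bne by (metis One_nat_def length_Cons list.exhaust list.size(3))
        have dist: "distinct (branches L ts)" by (simp add: branches_def)
        have pos: "card (branch L l) > 0" if "l \<in> set (branches L ts)" for l
          using that by (auto simp: set_branches card_gt_0_iff finite_branch fin)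
        have sum2: "card (branch L i) + (card (branch L j) + (\<Sum>l\<in>set r. card (branch L l))) = 2"
          using card dist unfolding ij by simp
        have "card (branch L i) > 0" "card (branch L j) > 0"
          using pos unfolding ij by simp_all
        \<comment> \<open>Positive branch cardinalities add up to 2, so the first two are 1 and no
          further branch is met.\<close>
        with sum2 have c1: "card (branch L i) = 1" "card (branch L j) = 1"
          and r0: "(\<Sum>l\<in>set r. card (branch L l)) = 0"
          by linarith+
        have "card (branch L l) = 0" "card (branch L l) > 0" if "l \<in> set r" for l
          using r0 pos[of l] that unfolding ij by simp_all
        hence "r = []" by (cases r) (simp_all, metis not_less0)
        have "induced_subtree (branch L l) (ts ! l) = Node []" if "card (branch L l) = 1" for l
          using that branch_subset[OF Node.prems(1)]
          by (subst induced_subtree_Leaf_iff) auto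
        thus ?thesis using c1 ij \<open>r = []\<close>
          by (auto simp: induced_subtree_several numeral_2_eq_2 tree_iso_Node2_iff)
      qed
    qed
  qed
  thus ?thesis by (auto simp: copy_sets_def leaf_count_caterpillar)
qed

lemma copies_cherry: "copies (caterpillar 2) T = leaf_count T choose 2"
  by (simp add: copies_eq_card copy_sets_cherry n_subsets finite_leaves leaf_count_def)

section \<open>Splitting the copies at the root\<close>

lemma caterpillar_Suc: "k \<ge> 1 \<Longrightarrow> caterpillar (Suc k) = Node [Node [], caterpillar k]"
  by (cases k) auto

text \<open>The root of the larger caterpillar has exactly two children, a leaf and the smaller
  caterpillar, so a copy not contained in one branch meets exactly two of them.\<close>

lemma copy_sets_caterpillar_Node:
  assumes k: "k \<ge> 2" and ts: "ts \<noteq> []"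
  shows "copy_sets (caterpillar (Suc k)) (Node ts) =
    (\<Union>i<length ts. (`) ((#) i) ` copy_sets (caterpillar (Suc k)) (ts ! i)) \<union>
    (\<Union>(i, j)\<in>{(i, j). i < length ts \<and> j < length ts \<and> i \<noteq> j}.
        (\<lambda>(p, M). insert (i # p) ((#) j ` M)) `
          (leaves (ts ! i) \<times> copy_sets (caterpillar k) (ts ! j)))"
    (is "?C = ?A \<union> ?B")
proof (intro equalityI subsetI)
  have cat: "caterpillar (Suc k) = Node [Node [], caterpillar k]"
    using k by (simp add: caterpillar_Suc)
  fix L assume "L \<in> ?C"
  hence sub: "L \<subseteq> leaves (Node ts)" and card: "card L = Suc k"
    and iso: "tree_iso (induced_subtree L (Node ts)) (caterpillar (Suc k))"
    using k by (auto simp: copy_sets_def leaf_count_caterpillar simp del: leaves.simps)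
  have ne: "L \<noteq> {}" using card by auto
  have bne: "branches L ts \<noteq> []" using length_branches_pos sub ne ts by blast
  have cardL: "card L = (\<Sum>i\<in>set (branches L ts). card (branch L i))"
    using card_union_branches sub ts by blast
  have L: "L = (\<Union>i\<in>set (branches L ts). (#) i ` branch L i)"
    using union_branches sub ts by blast
  show "L \<in> ?A \<union> ?B"
  proof (cases "length (branches L ts) = 1")
    case True
    then obtain i where i: "branches L ts = [i]" by (auto simp: length_Suc_conv)
    hence "i \<in> set (branches L ts)" by simp
    hence "i < length ts" by (auto simp: set_branches)
    moreover have "L = (#) i ` branch L i" using L i by auto
    moreover have "branch L i \<in> copy_sets (caterpillar (Suc k)) (ts ! i)"
      using iso branch_subset[OF sub, of i] card cardL k i
      by (simp add: copy_sets_def induced_subtree_single leaf_count_caterpillar)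
    ultimately have "L \<in> ?A" by (intro UN_I[of i]) auto
    thus ?thesis ..
  next
    case False
    from iso have "\<exists>x y. map (\<lambda>i. induced_subtree (branch L i) (ts ! i)) (branches L ts) = [x, y] \<and>
       (tree_iso x (Node []) \<and> tree_iso y (caterpillar k) \<or> tree_iso x (caterpillar k) \<and> tree_iso y (Node []))"
      unfolding cat induced_subtree_several[OF False] tree_iso_Node2_iff .
    then obtain a b where ab: "branches L ts = [a, b]"
      and iso2: "tree_iso (induced_subtree (branch L a) (ts ! a)) (Node []) \<and>
                 tree_iso (induced_subtree (branch L b) (ts ! b)) (caterpillar k) \<or>
                 tree_iso (induced_subtree (branch L a) (ts ! a)) (caterpillar k) \<and>
                 tree_iso (induced_subtree (branch L b) (ts ! b)) (Node [])"
      by auto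
    have "distinct (branches L ts)" by (simp add: branches_def)
    with ab have "a \<noteq> b" by simp
    \<comment> \<open>The index \<open>i\<close> is the branch with the single leaf and
      \<open>j\<close> the other one, irrespective of their order in the sorted list.\<close>
    with iso2 obtain i j where ij: "set (branches L ts) = {i, j}" "i \<noteq> j"
      and isoi: "induced_subtree (branch L i) (ts ! i) = Node []"
      and isoj: "tree_iso (induced_subtree (branch L j) (ts ! j)) (caterpillar k)"
      using ab by (auto simp: insert_commute)
    have lt: "i < length ts" "j < length ts" "branch L i \<noteq> {}"
      using ij set_branches[of L ts] by auto
    have "card (branch L i) = 1"
      using isoi induced_subtree_Leaf_iff[OF branch_subset[OF sub] lt(3)] by simp
    then obtain p where p: "branch L i = {p}" by (auto simp: card_1_singleton_iff)
    have "card (branch L j) = k" using cardL card ij p by simp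
    hence "branch L j \<in> copy_sets (caterpillar k) (ts ! j)"
      using isoj branch_subset[OF sub] k by (auto simp: copy_sets_def leaf_count_caterpillar)
    moreover have "L = insert (i # p) ((#) j ` branch L j)" using L p ij by auto
    moreover have "p \<in> leaves (ts ! i)" using p branch_subset[OF sub, of i] by auto
    ultimately have "L \<in> (\<lambda>(p, M). insert (i # p) ((#) j ` M)) `
        (leaves (ts ! i) \<times> copy_sets (caterpillar k) (ts ! j))" by (intro image_eqI[of _ _ "(p, branch L j)"]) auto
    hence "L \<in> ?B" using lt ij(2) by (intro UN_I[of "(i, j)"]) auto
    thus ?thesis ..
  qed
next
  have cat: "caterpillar (Suc k) = Node [Node [], caterpillar k]"
    using k by (simp add: caterpillar_Suc)
  fix L assume "L \<in> ?A \<union> ?B"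
  thus "L \<in> ?C"
  proof
    assume "L \<in> ?A"
    then obtain i M where i: "i < length ts" and L: "L = (#) i ` M"
      and M: "M \<in> copy_sets (caterpillar (Suc k)) (ts ! i)" by auto
    from M have M': "M \<subseteq> leaves (ts ! i)" "card M = Suc k"
       "tree_iso (induced_subtree M (ts ! i)) (caterpillar (Suc k))"
      using k by (auto simp: copy_sets_def leaf_count_caterpillar)
    have "M \<noteq> {}" using M' by auto
    hence "branches L ts = [i]" using i L by (intro branches_eqI) auto
    hence "induced_subtree L (Node ts) = induced_subtree M (ts ! i)"
      using L by (simp add: induced_subtree_single)
    moreover have "L \<subseteq> leaves (Node ts)" using M'(1) L i ts by auto
    moreover have "card L = Suc k" using M'(2) L by (simp add: card_image)
    ultimately show ?thesis
      using M' k by (simp add: copy_sets_def leaf_count_caterpillar)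
  next
    assume "L \<in> ?B"
    then obtain i j p M where i: "i < length ts" and j: "j < length ts" and ij: "i \<noteq> j"
      and p: "p \<in> leaves (ts ! i)" and L: "L = insert (i # p) ((#) j ` M)"
      and M: "M \<in> copy_sets (caterpillar k) (ts ! j)" by auto
    from M have M': "M \<subseteq> leaves (ts ! j)" "card M = k"
       "tree_iso (induced_subtree M (ts ! j)) (caterpillar k)"
      using k by (auto simp: copy_sets_def leaf_count_caterpillar)
    have Mne: "M \<noteq> {}" using M' k by auto
    have bi: "branch L i = {p}" and bj: "branch L j = M" using L ij by auto
    have br: "branches L ts = (if i < j then [i, j] else [j, i])"
      using i j ij L Mne by (intro branches_eqI) auto
    have "induced_subtree {p} (ts ! i) = Node []"
      using p by (subst induced_subtree_Leaf_iff) auto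
    hence "tree_iso (induced_subtree L (Node ts)) (caterpillar (Suc k))"
      using M'(3) bi bj unfolding cat
      by (subst induced_subtree_several) (auto simp: br tree_iso_Node2_iff)
    moreover have "L \<subseteq> leaves (Node ts)" using M'(1) L i j p ts by auto
    moreover have "card L = Suc k"
    proof -
      have "finite M" using M'(1) finite_leaves finite_subset by blast
      thus ?thesis using M'(2) L ij by (subst L, subst card_insert_disjoint) (auto simp: card_image)
    qed
    ultimately show ?thesis
      using k by (simp add: copy_sets_def leaf_count_caterpillar)
  qed
qed

text \<open>The pieces of the decomposition are disjoint: the cardinalities of the branches of
  \<open>L\<close> reveal the piece, because k >= 2 tells the branch with one leaf from the branch
  with \<open>k\<close> leaves. Each parametrization of a piece is injective.\<close>

lemma copies_caterpillar_Node_sum: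
  assumes k: "k \<ge> 2" and ts: "ts \<noteq> []"
  shows "copies (caterpillar (Suc k)) (Node ts) =
    (\<Sum>i<length ts. copies (caterpillar (Suc k)) (ts ! i)) +
    (\<Sum>(i, j)\<in>{(i, j). i < length ts \<and> j < length ts \<and> i \<noteq> j}.
        leaf_count (ts ! i) * copies (caterpillar k) (ts ! j))"
proof -
  define P where "P = {(i, j). i < length ts \<and> j < length ts \<and> i \<noteq> j}"
  define S where "S = (\<lambda>i. (`) ((#) i) ` copy_sets (caterpillar (Suc k)) (ts ! i))"
  define R where "R = (\<lambda>(i, j). (\<lambda>(p, M). insert (i # p) ((#) j ` M)) `
          (leaves (ts ! i) \<times> copy_sets (caterpillar k) (ts ! j)))"
  have finP: "finite P"
    by (rule finite_subset[of _ "{..<length ts} \<times> {..<length ts}"]) (auto simp: P_def)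
  have S: "\<exists>M. M \<noteq> {} \<and> L = (#) i ` M" if L: "L \<in> S i" for L i
  proof -
    obtain M where M: "L = (#) i ` M" "M \<in> copy_sets (caterpillar (Suc k)) (ts ! i)"
      using L by (auto simp: S_def)
    hence "card M = Suc k" by (simp add: copy_sets_def leaf_count_caterpillar)
    thus ?thesis using M by (intro exI[of _ M]) auto
  qed
  have R: "\<exists>p M. card M = k \<and> L = insert (i # p) ((#) j ` M)"
    if L: "L \<in> R (i, j)" for L i j
  proof -
    obtain p M where M: "L = insert (i # p) ((#) j ` M)" "M \<in> copy_sets (caterpillar k) (ts ! j)"
      using L by (auto simp: R_def)
    moreover have "card M = k" using M(2) k by (simp add: copy_sets_def leaf_count_caterpillar)
    ultimately show ?thesis by blast
  qed
  have brR: "i \<noteq> j \<and> (\<forall>l. card (branch L l) = (if l = i then 1 else if l = j then k else 0))"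
    if "L \<in> R (i, j)" "(i, j) \<in> P" for L i j
    using R[OF that(1)] that(2) by (auto simp: P_def)
  have finS: "finite (S i)" for i by (simp add: S_def finite_copy_sets)
  have finR: "finite (R x)" for x by (auto simp: R_def finite_copy_sets finite_leaves split: prod.split)
  have dS: "S i \<inter> S j = {}" if "i \<noteq> j" for i j
  proof (rule ccontr)
    assume "S i \<inter> S j \<noteq> {}"
    then obtain L where L: "L \<in> S i" "L \<in> S j" by blast
    obtain M where M: "M \<noteq> {}" "L = (#) i ` M" using S[OF L(1)] by blast
    obtain N where "L = (#) j ` N" using S[OF L(2)] by blast
    hence "branch L i = {}" using that by simp
    thus False using M by simp
  qed
  have dR: "R x \<inter> R y = {}" if "x \<in> P" "y \<in> P" "x \<noteq> y" for x y
  proof (rule ccontr)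
    obtain i j i' j' where xy: "x = (i, j)" "y = (i', j')" by (metis surj_pair)
    assume "R x \<inter> R y \<noteq> {}"
    then obtain L where L: "L \<in> R (i, j)" "L \<in> R (i', j')" using xy by auto
    note br = brR[OF L(1) that(1)[unfolded xy]] brR[OF L(2) that(2)[unfolded xy]]
    from br have ne: "i \<noteq> j" "i' \<noteq> j'" by blast+
    have eq: "(if l = i then 1 else if l = j then k else 0) =
              (if l = i' then 1 else if l = j' then k else (0::nat))" for l
      using br[THEN conjunct2, THEN spec, of l] by (rule trans[OF sym])
    have "i = i'" using eq[of i] k by (auto split: if_splits)
    moreover have "j = j'" using eq[of j] k ne by (auto split: if_splits)
    ultimately show False using that xy by auto
  qed
  have dSR: "S i \<inter> R x = {}" if "x \<in> P" for i x
  proof (rule ccontr)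
    obtain a b where x: "x = (a, b)" by (metis surj_pair)
    assume "S i \<inter> R x \<noteq> {}"
    then obtain L where L: "L \<in> S i" "L \<in> R (a, b)" using x by auto
    from S[OF L(1)] have "\<forall>l. l \<noteq> i \<longrightarrow> card (branch L l) = 0" by auto
    with brR[OF L(2)] that x have "a = i" "b = i" using k by (metis zero_neq_one not_numeral_le_zero)+
    thus False using brR[OF L(2)] that x by auto
  qed
  have cS: "card (S i) = copies (caterpillar (Suc k)) (ts ! i)" for i
    unfolding S_def copies_eq_card
    by (rule card_image) (auto intro!: inj_onI dest: inj_image_eq_iff[THEN iffD1, rotated])
  have cR: "card (R x) = (case x of (i, j) \<Rightarrow> leaf_count (ts ! i) * copies (caterpillar k) (ts ! j))"
    if "x \<in> P" for x
  proof -
    obtain i j where x: "x = (i, j)" by (metis surj_pair)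
    have "i \<noteq> j" using that x by (simp add: P_def)
    have "inj_on (\<lambda>(p, M). insert (i # p) ((#) j ` M)) (leaves (ts ! i) \<times> copy_sets (caterpillar k) (ts ! j))"
    proof (rule inj_onI, clarify)
      fix p M p' M' assume eq: "insert (i # p) ((#) j ` M) = insert (i # p') ((#) j ` M')"
      have "branch (insert (i # p) ((#) j ` M)) l = branch (insert (i # p') ((#) j ` M')) l" for l
        using eq by simp
      from this[of i] this[of j] show "p = p' \<and> M = M'" using \<open>i \<noteq> j\<close> by simp
    qed
    thus ?thesis
      by (simp add: x R_def card_image card_cartesian_product copies_eq_card leaf_count_def)
  qed
  have "copies (caterpillar (Suc k)) (Node ts) = card ((\<Union>i<length ts. S i) \<union> (\<Union>x\<in>P. R x))"
    unfolding copies_eq_card copy_sets_caterpillar_Node[OF assms] S_def R_def P_def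
    by (rule arg_cong[of _ _ card]) (auto simp: split_def)
  also have "\<dots> = card (\<Union>i<length ts. S i) + card (\<Union>x\<in>P. R x)"
  proof (rule card_Un_disjoint)
    show "(\<Union>i<length ts. S i) \<inter> (\<Union>x\<in>P. R x) = {}" using dSR by blast
  qed (use finS finR finP in auto)
  also have "card (\<Union>i<length ts. S i) = (\<Sum>i<length ts. card (S i))"
    by (rule card_UN_disjoint) (use finS dS in auto)
  also have "card (\<Union>x\<in>P. R x) = (\<Sum>x\<in>P. card (R x))"
    by (rule card_UN_disjoint) (use finR finP dR in auto)
  also have "\<dots> = (\<Sum>(i, j)\<in>P. leaf_count (ts ! i) * copies (caterpillar k) (ts ! j))"
    by (intro sum.cong refl cR)
  finally show ?thesis by (simp add: cS P_def)
qed

text \<open>For a fixed branch \<open>t\<close> carrying the smaller caterpillar, the extra leaf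
  ranges over the n - x_t leaves outside \<open>t\<close>.\<close>

lemma copies_caterpillar_Node:
  assumes k: "k \<ge> 2" and ts: "ts \<noteq> []"
  shows "real (copies (caterpillar (Suc k)) (Node ts)) =
    (\<Sum>t\<leftarrow>ts. real (copies (caterpillar (Suc k)) t) +
        (real (leaf_count (Node ts)) - real (leaf_count t)) * real (copies (caterpillar k) t))"
proof -
  let ?m = "length ts"
  have n: "real (leaf_count (Node ts)) = (\<Sum>i<?m. real (leaf_count (ts ! i)))"
    using ts by (simp add: leaf_count_Node sum_list_sum_nth atLeast0LessThan)
  have "{(i, j). i < ?m \<and> j < ?m \<and> i \<noteq> j} = (\<lambda>(j, i). (i, j)) ` (SIGMA j:{..<?m}. {..<?m} - {j})"
    by (auto simp: image_def)
  hence "(\<Sum>(i, j)\<in>{(i, j). i < ?m \<and> j < ?m \<and> i \<noteq> j}.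
        real (leaf_count (ts ! i)) * real (copies (caterpillar k) (ts ! j))) =
      (\<Sum>(j, i)\<in>(SIGMA j:{..<?m}. {..<?m} - {j}).
        real (leaf_count (ts ! i)) * real (copies (caterpillar k) (ts ! j)))"
    by (simp add: sum.reindex inj_on_def split_def)
  also have "\<dots> = (\<Sum>j<?m. \<Sum>i\<in>{..<?m} - {j}. real (leaf_count (ts ! i)) * real (copies (caterpillar k) (ts ! j)))"
    by (subst sum.Sigma) auto
  also have "\<dots> = (\<Sum>j<?m. (real (leaf_count (Node ts)) - real (leaf_count (ts ! j))) * real (copies (caterpillar k) (ts ! j)))"
    by (intro sum.cong refl) (simp add: n sum_diff1 flip: sum_distrib_right)
  finally show ?thesis
    unfolding copies_caterpillar_Node_sum[OF assms]
    by (simp add: sum_list_sum_nth atLeast0LessThan sum.distrib split_def)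
qed

section \<open>Power sums\<close>

text \<open>With m = l + 1 the difference of the two sides is (n - a - b)(a^m - b^m) + ab(a^l -
  b^l), a sum of two nonnegative terms.\<close>

lemma power_times_complement_mono:
  fixes a b n :: real
  assumes "0 \<le> b" "b \<le> a" "a + b \<le> n" "m \<ge> 1"
  shows "b ^ m * (n - b) \<le> a ^ m * (n - a)"
proof -
  obtain l where m: "m = Suc l" using \<open>m \<ge> 1\<close> by (cases m) auto
  have "0 \<le> (n - (a + b)) * (a ^ m - b ^ m) + a * b * (a ^ l - b ^ l)"
    using assms by (intro add_nonneg_nonneg mult_nonneg_nonneg) (auto intro: power_mono)
  also have "\<dots> = a ^ m * (n - a) - b ^ m * (n - b)"
    by (simp add: m algebra_simps)
  finally show ?thesis by simp
qed

text \<open>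
  Chebyshev's sum inequality, as the step from \<open>m\<close> to \<open>m + 1\<close>: on numbers of which any two
  add up to at most \<open>n\<close>, the function \<open>x^m (n - x)\<close> is similarly ordered to \<open>x\<close>, although
  it is not monotone on the whole interval from \<open>0\<close> to \<open>n\<close>.
\<close>

lemma power_sum_step:
  fixes x :: "'a \<Rightarrow> real"
  assumes fin: "finite A" and nonneg: "\<And>i. i \<in> A \<Longrightarrow> 0 \<le> x i" and n: "n = sum x A" and m: "m \<ge> 1"
  shows "n * (\<Sum>i\<in>A. x i ^ m * (n - x i)) \<le> real (card A) * (\<Sum>i\<in>A. x i ^ Suc m * (n - x i))"
proof -
  define g where "g i = x i ^ m * (n - x i)" for i
  have pair: "0 \<le> (x i - x j) * (g i - g j)" if "i \<in> A" "j \<in> A" for i j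
  proof (cases "i = j")
    case False
    have "x i + x j = sum x {i, j}" using False by simp
    also have "\<dots> \<le> n" unfolding n using that fin nonneg by (intro sum_mono2) auto
    finally have le: "x i + x j \<le> n" .
    show ?thesis
    proof (cases "x j \<le> x i")
      case True
      hence "g j \<le> g i" unfolding g_def
        using le nonneg that m by (intro power_times_complement_mono) auto
      thus ?thesis using True by simp
    next
      case False
      hence "g i \<le> g j" unfolding g_def
        using le nonneg that m by (intro power_times_complement_mono) auto
      thus ?thesis using False by (intro mult_nonpos_nonpos) auto
    qed
  qed simp
  have double: "(\<Sum>i\<in>A. \<Sum>j\<in>A. g i * (x i - x j)) =
      real (card A) * (\<Sum>i\<in>A. g i * x i) - n * (\<Sum>i\<in>A. g i)"
    by (simp add: right_diff_distrib sum_subtractf n sum_distrib_left sum_distrib_right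
        mult.commute mult.left_commute) (rule sum.swap)
  \<comment> \<open>Exchanging \<open>i\<close> and \<open>j\<close> shows this symmetric sum to be
    twice the one computed in \<open>double\<close>.\<close>
  have "0 \<le> (\<Sum>i\<in>A. \<Sum>j\<in>A. (x i - x j) * (g i - g j))"
    by (intro sum_nonneg pair)
  also have "\<dots> = (\<Sum>i\<in>A. \<Sum>j\<in>A. g i * (x i - x j)) + (\<Sum>i\<in>A. \<Sum>j\<in>A. g j * (x j - x i))"
    unfolding sum.distrib[symmetric] by (intro sum.cong refl) (simp add: algebra_simps)
  also have "(\<Sum>i\<in>A. \<Sum>j\<in>A. g j * (x j - x i)) = (\<Sum>i\<in>A. \<Sum>j\<in>A. g i * (x i - x j))"
    by (rule sum.swap)
  finally have "0 \<le> (\<Sum>i\<in>A. \<Sum>j\<in>A. g i * (x i - x j))" by simp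
  thus ?thesis unfolding double by (simp add: g_def algebra_simps)
qed

text \<open>Each of the \<open>l\<close> steps raises the exponent by one at the cost of a factor
  \<open>card A\<close>, which is at most \<open>d\<close>; the sums are nonnegative because every
  \<open>x i\<close> is at most \<open>n\<close>.\<close>

lemma power_sum_iterate:
  fixes x :: "'a \<Rightarrow> real"
  assumes fin: "finite A" and nonneg: "\<And>i. i \<in> A \<Longrightarrow> 0 \<le> x i" and n: "n = sum x A"
    and card: "card A \<le> d" and "m \<ge> 1"
  shows "n ^ l * (\<Sum>i\<in>A. x i ^ m * (n - x i)) \<le> real d ^ l * (\<Sum>i\<in>A. x i ^ (m + l) * (n - x i))"
proof (induction l)
  case (Suc l)
  have n0: "0 \<le> n" unfolding n by (intro sum_nonneg nonneg)
  have le: "x i \<le> n" if "i \<in> A" for i unfolding n using that nonneg fin by (intro member_le_sum) auto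
  have "n ^ Suc l * (\<Sum>i\<in>A. x i ^ m * (n - x i)) \<le> n * (real d ^ l * (\<Sum>i\<in>A. x i ^ (m + l) * (n - x i)))"
    using mult_left_mono[OF Suc.IH n0] by (simp add: mult_ac)
  also have "\<dots> \<le> real d ^ l * (real (card A) * (\<Sum>i\<in>A. x i ^ Suc (m + l) * (n - x i)))"
    using mult_left_mono[OF power_sum_step[OF fin nonneg n, of "m + l"], of "real d ^ l"] \<open>m \<ge> 1\<close>
    by (simp add: mult_ac)
  also have "\<dots> \<le> real d ^ l * (real d * (\<Sum>i\<in>A. x i ^ Suc (m + l) * (n - x i)))"
    using card nonneg le
    by (intro mult_left_mono mult_right_mono sum_nonneg mult_nonneg_nonneg) auto
  finally show ?case by (simp add: mult_ac)
qed simp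

text \<open>As \<open>n\<close> is the sum of the \<open>x i\<close>, the left side is the sum of
  x_i (n^k - x_i^k), and factoring each difference of powers gives the terms n^l x_i^(k-l) (n - x_i)
  with l < k, to which \<open>power_sum_iterate\<close> applies. Equality holds for \<open>d\<close>
  equal numbers, the case of the complete trees.\<close>

lemma power_diff_sum_le:
  fixes x :: "'a \<Rightarrow> real"
  assumes fin: "finite A" and nonneg: "\<And>i. i \<in> A \<Longrightarrow> 0 \<le> x i" and n: "n = sum x A"
    and card: "card A \<le> d"
  shows "n ^ Suc k - (\<Sum>i\<in>A. x i ^ Suc k) \<le> (\<Sum>l<k. real d ^ l) * (\<Sum>i\<in>A. x i ^ k * (n - x i))"
proof -
  have "n ^ Suc k - (\<Sum>i\<in>A. x i ^ Suc k) = (\<Sum>i\<in>A. x i * (n ^ k - x i ^ k))"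
    by (simp add: n right_diff_distrib sum_subtractf sum_distrib_right)
  also have "\<dots> = (\<Sum>i\<in>A. \<Sum>l<k. n ^ l * (x i ^ (k - l) * (n - x i)))"
  proof (rule sum.cong)
    fix i assume "i \<in> A"
    have "x i * (n ^ k - x i ^ k) = (\<Sum>l<k. x i * ((n - x i) * (x i ^ (k - Suc l) * n ^ l)))"
      by (simp add: power_diff_sumr2 sum_distrib_left mult_ac)
    also have "\<dots> = (\<Sum>l<k. n ^ l * (x i ^ (k - l) * (n - x i)))"
    proof (rule sum.cong)
      fix l assume "l \<in> {..<k}"
      hence "x i ^ (k - l) = x i * x i ^ (k - Suc l)"
        by (simp flip: power_Suc add: Suc_diff_Suc)
      thus "x i * ((n - x i) * (x i ^ (k - Suc l) * n ^ l)) = n ^ l * (x i ^ (k - l) * (n - x i))"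
        by (simp add: mult_ac)
    qed simp
    finally show "x i * (n ^ k - x i ^ k) = (\<Sum>l<k. n ^ l * (x i ^ (k - l) * (n - x i)))" .
  qed simp
  also have "\<dots> = (\<Sum>l<k. n ^ l * (\<Sum>i\<in>A. x i ^ (k - l) * (n - x i)))"
    by (subst sum.swap) (simp add: sum_distrib_left)
  also have "\<dots> \<le> (\<Sum>l<k. real d ^ l * (\<Sum>i\<in>A. x i ^ k * (n - x i)))"
  proof (rule sum_mono)
    fix l assume "l \<in> {..<k}"
    thus "n ^ l * (\<Sum>i\<in>A. x i ^ (k - l) * (n - x i)) \<le> real d ^ l * (\<Sum>i\<in>A. x i ^ k * (n - x i))"
      using power_sum_iterate[OF fin nonneg n card, of "k - l" l] by simp
  qed
  finally show ?thesis by (simp add: sum_distrib_right)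
qed

section \<open>Bounds on the number of caterpillars\<close>

text \<open>The limit density divided by \<open>k!\<close>.\<close>

definition cat_coeff :: "nat \<Rightarrow> nat \<Rightarrow> real" where
  "cat_coeff d k = (real d - 1) ^ (k - 1) * (\<Prod>j=1..k-1. inverse (real d ^ j - 1)) / 2"

lemma cat_coeff_2: "d \<ge> 2 \<Longrightarrow> cat_coeff d 2 = 1 / 2"
  by (simp add: cat_coeff_def)

text \<open>The factor (d - 1)/(d^k - 1) by which the coefficient changes is the reciprocal of the
  geometric sum, the same sum as in \<open>power_diff_sum_le\<close>.\<close>

lemma cat_coeff_Suc:
  assumes "d \<ge> 2" "k \<ge> 1"
  shows "cat_coeff d (Suc k) * (\<Sum>l<k. real d ^ l) = cat_coeff d k"
proof -
  obtain m where k: "k = Suc m" using \<open>k \<ge> 1\<close> by (cases k) auto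
  have "real d ^ k > 1" using assms by (intro one_less_power) auto
  moreover have "(real d - 1) * (\<Sum>l<k. real d ^ l) = real d ^ k - 1"
    by (simp add: power_diff_1_eq)
  moreover have "cat_coeff d (Suc k) * (\<Sum>l<k. real d ^ l) =
      cat_coeff d k * (((real d - 1) * (\<Sum>l<k. real d ^ l)) * inverse (real d ^ k - 1))"
    unfolding cat_coeff_def k by (simp add: mult_ac)
  ultimately show ?thesis by simp
qed

lemma cat_coeff_nonneg: "d \<ge> 2 \<Longrightarrow> cat_coeff d k \<ge> 0"
  unfolding cat_coeff_def
  by (intro mult_nonneg_nonneg divide_nonneg_nonneg prod_nonneg) (auto simp: one_le_power)

text \<open>The geometric sum is at least its term 1, so the coefficients do not increase from k = 2
  on. The bound settles the one-vertex tree in the lower estimate.\<close>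

lemma cat_coeff_le_half:
  assumes "d \<ge> 2" "k \<ge> 2"
  shows "cat_coeff d k \<le> 1 / 2"
  using assms(2)
proof (induction k rule: nat_induct_at_least)
  case base
  thus ?case using assms by (simp add: cat_coeff_2)
next
  case (Suc k)
  have "1 = (\<Sum>l<1. real d ^ l)" by simp
  also have "\<dots> \<le> (\<Sum>l<k. real d ^ l)" using Suc.hyps by (intro sum_mono2) auto
  finally have "cat_coeff d (Suc k) * 1 \<le> cat_coeff d (Suc k) * (\<Sum>l<k. real d ^ l)"
    by (rule mult_left_mono) (rule cat_coeff_nonneg[OF assms(1)])
  also have "\<dots> = cat_coeff d k" using Suc.hyps assms by (intro cat_coeff_Suc) auto
  finally have "cat_coeff d (Suc k) \<le> cat_coeff d k" by simp
  with Suc.IH show ?case by simp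
qed

section \<open>Lower bound for all d-ary trees\<close>

lemma choose_2_real: "real (n choose 2) = real n * (real n - 1) / 2"
proof (cases n)
  case (Suc m)
  have "2 dvd n * (n - 1)" by (simp add: Suc)
  thus ?thesis by (simp add: choose_two real_of_nat_div Suc algebra_simps)
qed simp

lemma d_ary_Node:
  "d_ary d (Node ts) \<Longrightarrow> length ts \<le> d \<and> (\<forall>i<length ts. d_ary d (ts ! i))"
  by (cases "ts = []") (auto simp: d_ary_def)

lemma leaf_count_Node_nth:
  "ts \<noteq> [] \<Longrightarrow> leaf_count (Node ts) = (\<Sum>i<length ts. leaf_count (ts ! i))"
  by (simp add: leaf_count_Node sum_list_sum_nth atLeast0LessThan)

text \<open>Induction on \<open>k\<close>, and inside it on \<open>T\<close>. The leading terms are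
  handled by \<open>power_diff_sum_le\<close>; the errors x^k / 2 + (n - x) x^(k-1) / 2 of the
  branches combine to n x^(k-1) / 2, so that the total error is again at most n^k / 2.\<close>

lemma copies_caterpillar_lower:
  assumes d: "d \<ge> 2" and k: "k \<ge> 2" and T: "d_ary d T"
  shows "cat_coeff d k * real (leaf_count T) ^ k - real (leaf_count T) ^ (k - 1) / 2
           \<le> real (copies (caterpillar k) T)"
  using k T
proof (induction k arbitrary: T rule: nat_induct_at_least)
  case base
  show ?case using d
    by (simp add: cat_coeff_2 copies_cherry choose_2_real power2_eq_square field_simps)
next
  case (Suc k)
  note k = Suc.hyps and IH = Suc.IH
  show ?case using Suc.prems
  proof (induction T)
    case (Node ts)
    show ?case
    proof (cases "ts = []")
      case True
      thus ?thesis using cat_coeff_le_half[of d "Suc k"] k d by (simp add: leaf_count_Leaf)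
    next
      case False
      define A where "A = {..<length ts}"
      define x where "x i = real (leaf_count (ts ! i))" for i
      define n where "n = real (leaf_count (Node ts))"
      define f where "f i = real (copies (caterpillar (Suc k)) (ts ! i))" for i
      define g where "g i = real (copies (caterpillar k) (ts ! i))" for i
      define \<alpha> where "\<alpha> = cat_coeff d (Suc k)"
      have n: "n = sum x A" using False by (simp add: n_def x_def A_def leaf_count_Node_nth)
      have x0: "0 \<le> x i" for i by (simp add: x_def)
      have n0: "0 \<le> n" by (simp add: n_def)
      have xn: "x i \<le> n" if "i \<in> A" for i
        unfolding n using that by (intro member_le_sum) (auto simp: A_def x0)
      have ary: "d_ary d (ts ! i)" if "i \<in> A" for i using d_ary_Node[OF Node.prems] that by (simp add: A_def)
      have f: "\<alpha> * x i ^ Suc k - x i ^ k / 2 \<le> f i" if "i \<in> A" for i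
        using Node.IH[of "ts ! i"] ary[OF that] that by (simp add: A_def x_def f_def \<alpha>_def)
      have g: "cat_coeff d k * x i ^ k - x i ^ (k - 1) / 2 \<le> g i" if "i \<in> A" for i
        using IH[of "ts ! i"] ary[OF that] by (simp add: x_def g_def)
      have xk: "x i ^ k = x i * x i ^ (k - 1)" for i using k by (cases k) auto
      have "n ^ Suc k - (\<Sum>i\<in>A. x i ^ Suc k) \<le> (\<Sum>l<k. real d ^ l) * (\<Sum>i\<in>A. x i ^ k * (n - x i))"
        using d_ary_Node[OF Node.prems] by (intro power_diff_sum_le n x0) (auto simp: A_def)
      hence "\<alpha> * (n ^ Suc k - (\<Sum>i\<in>A. x i ^ Suc k)) \<le>
               \<alpha> * (\<Sum>l<k. real d ^ l) * (\<Sum>i\<in>A. x i ^ k * (n - x i))"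
        unfolding mult.assoc \<alpha>_def by (rule mult_left_mono) (rule cat_coeff_nonneg[OF d])
      also have "\<alpha> * (\<Sum>l<k. real d ^ l) = cat_coeff d k"
        unfolding \<alpha>_def using k d by (intro cat_coeff_Suc) auto
      finally have main: "\<alpha> * n ^ Suc k \<le>
          \<alpha> * (\<Sum>i\<in>A. x i ^ Suc k) + cat_coeff d k * (\<Sum>i\<in>A. x i ^ k * (n - x i))"
        by (simp add: right_diff_distrib)
      \<comment> \<open>Here k >= 2 is used: one factor \<open>x i\<close> is kept so that the sum
        over the branches yields \<open>n\<close>, and the other k - 2 factors are bounded by
        \<open>n\<close>.\<close>
      have "n * (\<Sum>i\<in>A. x i ^ (k - 1)) \<le> n * (\<Sum>i\<in>A. x i * n ^ (k - 2))"
      proof (intro mult_left_mono sum_mono n0)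
        fix i assume i: "i \<in> A"
        have "x i ^ (k - 1) = x i * x i ^ (k - 2)"
          using k by (simp flip: power_Suc) (simp add: Suc_diff_Suc numeral_2_eq_2)
        also have "\<dots> \<le> x i * n ^ (k - 2)"
          by (intro mult_left_mono power_mono x0 xn i)
        finally show "x i ^ (k - 1) \<le> x i * n ^ (k - 2)" .
      qed
      also have "\<dots> = n * n ^ Suc (k - 2)"
        by (simp add: n sum_distrib_right)
      also have "\<dots> = n ^ k" using k by (simp flip: power_Suc) (simp add: Suc_diff_Suc numeral_2_eq_2)
      finally have err: "n * (\<Sum>i\<in>A. x i ^ (k - 1)) \<le> n ^ k" .
      have "\<alpha> * n ^ Suc k - n ^ k / 2 \<le> \<alpha> * (\<Sum>i\<in>A. x i ^ Suc k) +
          cat_coeff d k * (\<Sum>i\<in>A. x i ^ k * (n - x i)) - n * (\<Sum>i\<in>A. x i ^ (k - 1)) / 2"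
        using main err by linarith
      also have "\<dots> = (\<Sum>i\<in>A. (\<alpha> * x i ^ Suc k - x i ^ k / 2) +
                      (n - x i) * (cat_coeff d k * x i ^ k - x i ^ (k - 1) / 2))"
        by (simp add: sum.distrib sum_subtractf sum_distrib_left sum_divide_distrib diff_divide_distrib algebra_simps xk)
      also have "\<dots> \<le> (\<Sum>i\<in>A. f i + (n - x i) * g i)"
        using f g xn by (intro sum_mono add_mono mult_left_mono) auto
      also have "\<dots> = real (copies (caterpillar (Suc k)) (Node ts))"
        using copies_caterpillar_Node[OF k False]
        by (simp add: sum_list_sum_nth atLeast0LessThan A_def f_def g_def x_def n_def)
      finally show ?thesis by (simp add: \<alpha>_def n_def)
    qed
  qed
qed

section \<open>Upper bound for complete d-ary trees\<close>

primrec complete_tree :: "nat \<Rightarrow> nat \<Rightarrow> tree" where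
  "complete_tree d 0 = Node []"
| "complete_tree d (Suc h) = Node (replicate d (complete_tree d h))"

lemma leaf_count_complete_tree: "d \<ge> 1 \<Longrightarrow> leaf_count (complete_tree d h) = d ^ h"
  by (induction h) (auto simp: leaf_count_Leaf leaf_count_Node sum_list_replicate)

lemma strictly_d_ary_complete_tree: "d \<ge> 2 \<Longrightarrow> strictly_d_ary d (complete_tree d h)"
  by (induction h) (auto simp: strictly_d_ary_def d_ary_def split: if_splits)

text \<open>With \<open>d\<close> equal branches the recursion reproduces the leading term exactly,
  since 1 + (d - 1) times the geometric sum is d^k. Inequality enters only through the starting
  cases k = 2 and h = 0.\<close>

lemma copies_caterpillar_complete_tree:
  assumes d: "d \<ge> 2" and k: "k \<ge> 2"
  shows "real (copies (caterpillar k) (complete_tree d h)) \<le> cat_coeff d k * real (d ^ h) ^ k"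
  using k
proof (induction k arbitrary: h rule: nat_induct_at_least)
  case base
  show ?case using d
    by (simp add: cat_coeff_2 copies_cherry choose_2_real leaf_count_complete_tree
        power2_eq_square field_simps)
next
  case (Suc k)
  note k = Suc.hyps and IH = Suc.IH
  show ?case
  proof (induction h)
    case 0
    have "copies (caterpillar (Suc k)) (Node []) \<le> 1 choose Suc k"
      using copies_le[of "caterpillar (Suc k)" "Node []"] by (simp add: leaf_count_Leaf leaf_count_caterpillar)
    hence "copies (caterpillar (Suc k)) (Node []) = 0" using k by (simp add: binomial_eq_0)
    thus ?case by (simp add: cat_coeff_nonneg[OF d])
  next
    case (Suc h)
    define n where "n = real (d ^ h)"
    define \<alpha> where "\<alpha> = cat_coeff d (Suc k)"
    have geo: "(real d - 1) * (\<Sum>l<k. real d ^ l) = real d ^ k - 1"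
      by (simp add: power_diff_1_eq)
    have "real (copies (caterpillar (Suc k)) (complete_tree d (Suc h))) =
       real d * (real (copies (caterpillar (Suc k)) (complete_tree d h)) +
         (real d - 1) * n * real (copies (caterpillar k) (complete_tree d h)))"
      using d leaf_count_complete_tree[of d "Suc h"] leaf_count_complete_tree[of d h]
      by (simp add: copies_caterpillar_Node[OF k] sum_list_replicate n_def algebra_simps)
    also have "\<dots> \<le> real d * (\<alpha> * n ^ Suc k + (real d - 1) * n * (cat_coeff d k * n ^ k))"
      using Suc.IH IH[of h] d unfolding \<alpha>_def n_def
      by (intro mult_left_mono add_mono) auto
    also have "cat_coeff d k = \<alpha> * (\<Sum>l<k. real d ^ l)"
      unfolding \<alpha>_def using k d by (intro cat_coeff_Suc[symmetric]) auto
    also have "real d * (\<alpha> * n ^ Suc k + (real d - 1) * n * (\<alpha> * (\<Sum>l<k. real d ^ l) * n ^ k)) =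
       real d * (\<alpha> * n ^ Suc k * (1 + (real d - 1) * (\<Sum>l<k. real d ^ l)))"
      by (simp add: algebra_simps)
    also have "\<dots> = \<alpha> * real (d ^ Suc h) ^ Suc k"
      unfolding geo by (simp add: n_def power_mult_distrib)
    finally show ?case by (simp add: \<alpha>_def)
  qed
qed

section \<open>Deleting a leaf\<close>

text \<open>A root left with one child would have outdegree 1 and is erased.\<close>

fun contract :: "tree list \<Rightarrow> tree" where
  "contract [t] = t"
| "contract ts = Node ts"

text \<open>
  Deleting the only leaf of the one-vertex tree returns that tree; as it contains no caterpillar
  with at least two leaves, the averaging identity holds for it as well.
\<close>

fun delete_leaf :: "nat list \<Rightarrow> tree \<Rightarrow> tree" where
  "delete_leaf [] T = T"
| "delete_leaf (i # p) (Node ts) =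
     (if ts ! i = Node [] then contract (take i ts @ drop (Suc i) ts)
      else Node (ts[i := delete_leaf p (ts ! i)]))"

lemma leaf_count_contract: "leaf_count (contract ts) = leaf_count (Node ts)"
  by (cases ts rule: contract.cases) (auto simp: leaf_count_Node)

text \<open>In the recursion a single branch contains all \<open>n\<close> leaves, so the term with
  n - x_t vanishes.\<close>

lemma copies_caterpillar_contract:
  "k \<ge> 2 \<Longrightarrow> copies (caterpillar (Suc k)) (contract ts) = copies (caterpillar (Suc k)) (Node ts)"
proof (cases ts rule: contract.cases)
  case (1 t)
  assume "k \<ge> 2"
  hence "real (copies (caterpillar (Suc k)) (Node ts)) = real (copies (caterpillar (Suc k)) t)"
    by (simp add: 1 copies_caterpillar_Node leaf_count_Node)
  thus ?thesis by (simp add: 1)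
qed auto

lemma copies_caterpillar_Leaf: "k \<ge> 2 \<Longrightarrow> copies (caterpillar k) (Node []) = 0"
  using copies_le[of "caterpillar k" "Node []"]
  by (simp add: leaf_count_Leaf leaf_count_caterpillar binomial_eq_0)

lemma d_ary_Node_iff:
  "d_ary d (Node ts) \<longleftrightarrow> ts = [] \<or> 2 \<le> length ts \<and> length ts \<le> d \<and> (\<forall>t\<in>set ts. d_ary d t)"
  by (auto simp: d_ary_def)

lemma sum_list_map_update:
  fixes h :: "'a \<Rightarrow> 'b :: ab_group_add"
  assumes "i < length xs"
  shows "(\<Sum>x\<leftarrow>xs[i := y]. h x) = (\<Sum>x\<leftarrow>xs. h x) - h (xs ! i) + h y"
  using assms by (induction xs arbitrary: i) (auto split: nat.split)

lemma sum_list_map_remove: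
  fixes h :: "'a \<Rightarrow> 'b :: ab_group_add"
  assumes "i < length xs"
  shows "(\<Sum>x\<leftarrow>take i xs @ drop (Suc i) xs. h x) = (\<Sum>x\<leftarrow>xs. h x) - h (xs ! i)"
proof -
  have "(\<Sum>x\<leftarrow>xs. h x) = (\<Sum>x\<leftarrow>take i xs @ xs ! i # drop (Suc i) xs. h x)"
    using id_take_nth_drop[OF assms] by simp
  thus ?thesis by simp
qed

lemma real_leaf_count_Node:
  "ts \<noteq> [] \<Longrightarrow> real (leaf_count (Node ts)) = (\<Sum>t\<leftarrow>ts. real (leaf_count t))"
  by (simp add: leaf_count_Node_nth sum_list_sum_nth atLeast0LessThan)

lemma mem_leaves_Node:
  "ts \<noteq> [] \<Longrightarrow> p \<in> leaves (Node ts) \<longleftrightarrow> (\<exists>i q. p = i # q \<and> i < length ts \<and> q \<in> leaves (ts ! i))"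
  by auto

lemma leaf_count_delete_leaf:
  assumes "d_ary d T" "T \<noteq> Node []" "p \<in> leaves T"
  shows "real (leaf_count (delete_leaf p T)) = real (leaf_count T) - 1"
  using assms
proof (induction T arbitrary: p)
  case (Node ts)
  have len: "length ts \<ge> 2" using Node.prems by (auto simp: d_ary_Node_iff)
  hence ts: "ts \<noteq> []" by auto
  obtain i q where p: "p = i # q" and i: "i < length ts" and q: "q \<in> leaves (ts ! i)"
    using Node.prems(3) ts by (subst (asm) mem_leaves_Node) auto
  have ary: "d_ary d (ts ! i)" using Node.prems ts i by (simp add: d_ary_Node_iff)
  show ?case
  proof (cases "ts ! i = Node []")
    case True
    have ne: "take i ts @ drop (Suc i) ts \<noteq> []" using len i by auto
    have "delete_leaf p (Node ts) = contract (take i ts @ drop (Suc i) ts)"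
      using True by (simp add: p)
    thus ?thesis
      unfolding real_leaf_count_Node[OF ts]
      by (simp only: leaf_count_contract real_leaf_count_Node[OF ne] sum_list_map_remove[OF i])
         (simp add: True leaf_count_Leaf)
  next
    case False
    thus ?thesis using Node.IH[of "ts ! i" q] i q ary ts
      by (simp add: p real_leaf_count_Node sum_list_map_update)
  qed
qed

lemma d_ary_contract:
  assumes "length ts \<le> d" "\<And>t. t \<in> set ts \<Longrightarrow> d_ary d t"
  shows "d_ary d (contract ts)"
  using assms
  by (cases ts rule: contract.cases) (auto simp: d_ary_Node_iff)

text \<open>Only the parent of the leaf loses a child: if it had two, \<open>contract\<close> erases
  it, and otherwise its outdegree remains at least 2.\<close>

lemma d_ary_delete_leaf:
  assumes "d_ary d T" "p \<in> leaves T"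
  shows "d_ary d (delete_leaf p T)"
  using assms
proof (induction T arbitrary: p)
  case (Node ts)
  show ?case
  proof (cases "ts = []")
    case True
    thus ?thesis using Node.prems by simp
  next
    case False
    obtain i q where p: "p = i # q" and i: "i < length ts" and q: "q \<in> leaves (ts ! i)"
      using Node.prems(2) False by (subst (asm) mem_leaves_Node) auto
    have ary: "2 \<le> length ts" "length ts \<le> d" "\<And>t. t \<in> set ts \<Longrightarrow> d_ary d t"
      using Node.prems(1) False by (auto simp: d_ary_Node_iff)
    show ?thesis
    proof (cases "ts ! i = Node []")
      case True
      have "d_ary d (contract (take i ts @ drop (Suc i) ts))"
        using ary i by (intro d_ary_contract) (auto dest: in_set_takeD in_set_dropD)
      thus ?thesis by (simp add: p True)
    next
      case False
      have "d_ary d (delete_leaf q (ts ! i))" using Node.IH[of "ts ! i" q] i q ary by simp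
      thus ?thesis using False ary i
        by (auto simp: p d_ary_Node_iff dest!: set_update_subset_insert[THEN subsetD])
    qed
  qed
qed

section \<open>Averaging over the deleted leaf\<close>

lemma sum_leaves_Node:
  assumes "ts \<noteq> []"
  shows "(\<Sum>p\<in>leaves (Node ts). h p) = (\<Sum>i<length ts. \<Sum>q\<in>leaves (ts ! i). h (i # q))"
proof -
  have "(\<Sum>p\<in>leaves (Node ts). h p) = (\<Sum>p\<in>(\<Union>i<length ts. (#) i ` leaves (ts ! i)). h p)"
    using assms by simp
  also have "\<dots> = (\<Sum>i<length ts. \<Sum>p\<in>(#) i ` leaves (ts ! i). h p)"
    by (rule sum.UNION_disjoint) (auto simp: finite_leaves)
  finally show ?thesis by (simp add: sum.reindex)
qed

text \<open>The recursion for the smaller tree has n - 1 in place of \<open>n\<close>, and only the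
  tree in its \<open>i\<close>-th summand changes. There the weight is n - x_i, since total and
  branch both lose one leaf.\<close>

lemma copies_caterpillar_delete_leaf:
  assumes k: "k \<ge> 2" and ary: "d_ary d (Node ts)" and i: "i < length ts" and q: "q \<in> leaves (ts ! i)"
  defines "n \<equiv> real (leaf_count (Node ts))"
  shows "real (copies (caterpillar (Suc k)) (delete_leaf (i # q) (Node ts))) =
    (\<Sum>t\<leftarrow>ts. real (copies (caterpillar (Suc k)) t) +
        (n - 1 - real (leaf_count t)) * real (copies (caterpillar k) t))
    - (real (copies (caterpillar (Suc k)) (ts ! i)) +
        (n - 1 - real (leaf_count (ts ! i))) * real (copies (caterpillar k) (ts ! i)))
    + (real (copies (caterpillar (Suc k)) (delete_leaf q (ts ! i))) +
        (n - real (leaf_count (ts ! i))) * real (copies (caterpillar k) (delete_leaf q (ts ! i))))"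
proof -
  have ts: "ts \<noteq> []" using i by auto
  have len: "length ts \<ge> 2" using ary ts by (auto simp: d_ary_Node_iff)
  have aryi: "d_ary d (ts ! i)" using ary ts i by (simp add: d_ary_Node_iff)
  have "i # q \<in> leaves (Node ts)" using i q ts by auto
  hence n': "real (leaf_count (delete_leaf (i # q) (Node ts))) = n - 1"
    unfolding n_def using ary ts by (intro leaf_count_delete_leaf) auto
  show ?thesis
  proof (cases "ts ! i = Node []")
    case True
    have ne: "take i ts @ drop (Suc i) ts \<noteq> []" using len i by auto
    have del: "delete_leaf (i # q) (Node ts) = contract (take i ts @ drop (Suc i) ts)"
      using True by simp
    \<comment> \<open>A branch consisting of the deleted leaf disappears; its replacement in the
      formula is \<open>delete_leaf [] (Node [])\<close>, again a leaf, which contributes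
      zero.\<close>
    have q0: "q = []" using q True by simp
    show ?thesis
      using n' copies_caterpillar_Leaf[of "Suc k"] k
      unfolding del leaf_count_contract copies_caterpillar_contract[OF k]
        copies_caterpillar_Node[OF k ne] sum_list_map_remove[OF i]
      by (simp add: True q0 copies_caterpillar_Leaf)
  next
    case False
    have ne: "ts[i := delete_leaf q (ts ! i)] \<noteq> []" using ts by simp
    have del: "delete_leaf (i # q) (Node ts) = Node (ts[i := delete_leaf q (ts ! i)])"
      using False by simp
    show ?thesis
      using n' leaf_count_delete_leaf[OF aryi False q]
      unfolding del copies_caterpillar_Node[OF k ne] sum_list_map_update[OF i]
      by simp
  qed
qed

text \<open>This is double counting: a copy survives exactly the deletions of the n - k leaves
  outside it. As deletion changes leaf addresses, the identity is derived from the recursion by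
  induction on \<open>k\<close> and \<open>T\<close> instead of from a bijection of leaf
  sets.\<close>

lemma sum_copies_caterpillar_delete_leaf:
  assumes k: "k \<ge> 2" and T: "d_ary d T"
  shows "(\<Sum>p\<in>leaves T. real (copies (caterpillar k) (delete_leaf p T))) =
           (real (leaf_count T) - real k) * real (copies (caterpillar k) T)"
  using k T
proof (induction k arbitrary: T rule: nat_induct_at_least)
  case base
  show ?case
  proof (cases "T = Node []")
    case True
    thus ?thesis by (simp add: copies_caterpillar_Leaf)
  next
    case False
    \<comment> \<open>Each of the n deletions leaves C(n-1, 2) pairs, and n C(n-1, 2) = (n - 2) C(n,
      2).\<close>
    have "(\<Sum>p\<in>leaves T. real (copies (caterpillar 2) (delete_leaf p T))) =
          (\<Sum>p\<in>leaves T. (real (leaf_count T) - 1) * (real (leaf_count T) - 1 - 1) / 2)"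
      using leaf_count_delete_leaf[OF base False]
      by (intro sum.cong refl) (simp add: copies_cherry choose_2_real)
    thus ?thesis by (simp add: copies_cherry choose_2_real leaf_count_def)
  qed
next
  case (Suc k)
  note k = Suc.hyps and IH = Suc.IH
  show ?case using Suc.prems
  proof (induction T)
    case (Node ts)
    show ?case
    proof (cases "ts = []")
      case True
      thus ?thesis using copies_caterpillar_Leaf[of "Suc k"] k by simp
    next
      case False
      define A where "A = {..<length ts}"
      define x where "x i = real (leaf_count (ts ! i))" for i
      define n where "n = real (leaf_count (Node ts))"
      define f where "f i = real (copies (caterpillar (Suc k)) (ts ! i))" for i
      define g where "g i = real (copies (caterpillar k) (ts ! i))" for i
      \<comment> \<open>\<open>W\<close> is the recursion sum with total n - 1 but all branches
        intact; a deletion in branch \<open>i\<close> exchanges its \<open>i\<close>-th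
        summand.\<close>
      define W where "W = (\<Sum>i\<in>A. f i + (n - 1 - x i) * g i)"
      have n: "n = sum x A" using False by (simp add: n_def x_def A_def leaf_count_Node_nth)
      have ary: "d_ary d (ts ! i)" if "i \<in> A" for i
        using d_ary_Node[OF Node.prems] that by (simp add: A_def)
      have F: "real (copies (caterpillar (Suc k)) (Node ts)) = (\<Sum>i\<in>A. f i + (n - x i) * g i)"
        using copies_caterpillar_Node[OF k False]
        by (simp add: sum_list_sum_nth atLeast0LessThan A_def f_def g_def x_def n_def)
      have "(\<Sum>p\<in>leaves (Node ts). real (copies (caterpillar (Suc k)) (delete_leaf p (Node ts)))) =
            (\<Sum>i\<in>A. \<Sum>q\<in>leaves (ts ! i). real (copies (caterpillar (Suc k)) (delete_leaf (i # q) (Node ts))))"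
        unfolding A_def by (rule sum_leaves_Node[OF False])
      also have "\<dots> = (\<Sum>i\<in>A. x i * (W - (f i + (n - 1 - x i) * g i)) +
          ((x i - real (Suc k)) * f i + (n - x i) * ((x i - real k) * g i)))"
      proof (rule sum.cong)
        fix i assume i: "i \<in> A"
        have "(\<Sum>q\<in>leaves (ts ! i). real (copies (caterpillar (Suc k)) (delete_leaf (i # q) (Node ts)))) =
          (\<Sum>q\<in>leaves (ts ! i). (W - (f i + (n - 1 - x i) * g i)) +
            (real (copies (caterpillar (Suc k)) (delete_leaf q (ts ! i))) +
             (n - x i) * real (copies (caterpillar k) (delete_leaf q (ts ! i)))))"
          using i copies_caterpillar_delete_leaf[OF k Node.prems, of i]
          by (intro sum.cong refl)
             (simp add: A_def W_def f_def g_def x_def n_def sum_list_sum_nth atLeast0LessThan)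
        also have "\<dots> = x i * (W - (f i + (n - 1 - x i) * g i)) +
          ((\<Sum>q\<in>leaves (ts ! i). real (copies (caterpillar (Suc k)) (delete_leaf q (ts ! i)))) +
           (n - x i) * (\<Sum>q\<in>leaves (ts ! i). real (copies (caterpillar k) (delete_leaf q (ts ! i)))))"
          by (simp add: sum.distrib sum_distrib_left x_def leaf_count_def)
        also have "(\<Sum>q\<in>leaves (ts ! i). real (copies (caterpillar (Suc k)) (delete_leaf q (ts ! i)))) =
            (x i - real (Suc k)) * f i"
          using Node.IH[of "ts ! i"] ary[OF i] i by (simp add: A_def x_def f_def)
        also have "(\<Sum>q\<in>leaves (ts ! i). real (copies (caterpillar k) (delete_leaf q (ts ! i)))) =
            (x i - real k) * g i"
          using IH[OF ary[OF i]] by (simp add: x_def g_def)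
        finally show "(\<Sum>q\<in>leaves (ts ! i). real (copies (caterpillar (Suc k)) (delete_leaf (i # q) (Node ts)))) =
          x i * (W - (f i + (n - 1 - x i) * g i)) +
          ((x i - real (Suc k)) * f i + (n - x i) * ((x i - real k) * g i))" .
      qed simp
      \<comment> \<open>Apart from \<open>x i * W\<close>, the coefficient of \<open>g i\<close> is
        n - (k + 1)(n - x_i) and that of \<open>f i\<close> is -(k + 1).\<close>
      also have "\<dots> = (\<Sum>i\<in>A. x i * W + (n * g i - real (Suc k) * (f i + (n - x i) * g i)))"
        by (intro sum.cong refl) (simp add: algebra_simps)
      also have "\<dots> = n * W + (n * (\<Sum>i\<in>A. g i) - real (Suc k) * (\<Sum>i\<in>A. f i + (n - x i) * g i))"
        unfolding sum.distrib[of "\<lambda>i. x i * W"] sum_subtractf sum_distrib_left[symmetric]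
          sum_distrib_right[symmetric] n[symmetric] ..
      \<comment> \<open>Lowering the total by one costs one \<open>g i\<close> per branch, and this
        loss cancels the remaining multiple of the sum of the \<open>g i\<close>.\<close>
      also have "W = (\<Sum>i\<in>A. f i + (n - x i) * g i) - (\<Sum>i\<in>A. g i)"
        unfolding W_def sum_subtractf[symmetric] by (intro sum.cong refl) (simp add: algebra_simps)
      finally show ?thesis
        unfolding F by (simp add: n_def algebra_simps)
    qed
  qed
qed

text \<open>The mean count after a deletion is (n + 1 - k)/(n + 1) times the count in
  \<open>T\<close>, and C(n, k) / C(n + 1, k) is the same ratio. Hence the mean density equals that
  of \<open>T\<close>, and some deletion does not exceed it.\<close>

lemma density_delete_leaf:
  assumes k: "k \<ge> 2" and T: "d_ary d T" "leaf_count T = Suc n" and n: "n \<ge> k"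
  shows "\<exists>S. d_ary d S \<and> leaf_count S = n \<and> density (caterpillar k) S \<le> density (caterpillar k) T"
proof -
  let ?c = "\<lambda>T. real (copies (caterpillar k) T)"
  have "T \<noteq> Node []" using T(2) n k by (auto simp: leaf_count_Leaf)
  note del = leaf_count_delete_leaf[OF T(1) this]
  have card: "card (leaves T) = Suc n" using T(2) by (simp add: leaf_count_def)
  have "\<exists>p\<in>leaves T. real (Suc n) * ?c (delete_leaf p T) \<le> (real (Suc n) - real k) * ?c T"
  proof (rule ccontr)
    assume "\<not> ?thesis"
    hence "(\<Sum>p\<in>leaves T. (real (Suc n) - real k) * ?c T) < (\<Sum>p\<in>leaves T. real (Suc n) * ?c (delete_leaf p T))"
      using card by (intro sum_strict_mono finite_leaves) (auto simp: not_le)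
    also have "\<dots> = real (Suc n) * ((real (Suc n) - real k) * ?c T)"
      using sum_copies_caterpillar_delete_leaf[OF k T(1)] by (simp add: T(2) flip: sum_distrib_left)
    finally show False by (simp add: card)
  qed
  then obtain p where p: "p \<in> leaves T"
    and le: "real (Suc n) * ?c (delete_leaf p T) \<le> (real (Suc n) - real k) * ?c T" by blast
  let ?S = "delete_leaf p T"
  have S: "leaf_count ?S = n" using del[OF p] T(2) by simp
  have pos: "0 < real (Suc n choose k)" "0 < real (n choose k)" using n by simp_all
  have absorb: "(real (Suc n) - real k) * real (Suc n choose k) = real (Suc n) * real (n choose k)"
  proof -
    have "(Suc n - k) * (Suc n choose k) = Suc n * (n choose k)"
      using binomial_absorb_comp[of "Suc n" k] by simp
    hence "real ((Suc n - k) * (Suc n choose k)) = real (Suc n * (n choose k))" by simp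
    thus ?thesis using n by (simp only: of_nat_mult of_nat_diff)
  qed
  have "(real (Suc n) - real k) * (?c ?S * real (Suc n choose k)) =
        real (Suc n) * ?c ?S * real (n choose k)"
    using absorb by (simp add: mult_ac)
  also have "\<dots> \<le> (real (Suc n) - real k) * ?c T * real (n choose k)"
    by (rule mult_right_mono[OF le]) simp
  finally have "?c ?S * real (Suc n choose k) \<le> ?c T * real (n choose k)"
    using n by (simp add: mult.assoc)
  hence "density (caterpillar k) ?S \<le> density (caterpillar k) T"
    using pos k by (simp add: density_def S T(2) leaf_count_caterpillar divide_simps)
  thus ?thesis using d_ary_delete_leaf[OF T(1) p] S by blast
qed

text \<open>Leaves are deleted one by one until \<open>n\<close> remain, never raising the density;
  the resulting tree competes in the minimum.\<close>

lemma Min_density_le: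
  assumes k: "k \<ge> 2" and n: "n \<ge> k" and T: "d_ary d T" "leaf_count T \<ge> n"
  shows "Min (density (caterpillar k) ` {T. d_ary d T \<and> leaf_count T = n}) \<le> density (caterpillar k) T"
proof -
  let ?M = "Min (density (caterpillar k) ` {T. d_ary d T \<and> leaf_count T = n})"
  have "?M \<le> density (caterpillar k) T" if "d_ary d T" "leaf_count T = n + m" for m T
    using that
  proof (induction m arbitrary: T)
    case 0
    thus ?case by (intro Min_le finite_densities) auto
  next
    case (Suc m)
    then obtain S where S: "d_ary d S" "leaf_count S = n + m"
      "density (caterpillar k) S \<le> density (caterpillar k) T"
      using density_delete_leaf[OF k, of d T "n + m"] n by auto
    note Suc.IH[OF S(1,2)]
    also note S(3)
    finally show ?case .
  qed
  from this[of T "leaf_count T - n"] show ?thesis using T by simp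
qed

section \<open>The limit inferior of the density\<close>

text \<open>The quotient is k! divided by the product of the factors 1 - i/n for i < k, each of
  which tends to 1.\<close>

lemma power_over_binomial_LIMSEQ: "(\<lambda>n. real n ^ k / real (n choose k)) \<longlonglongrightarrow> fact k"
proof -
  have "(\<lambda>n. (real n - real i) / real n) \<longlonglongrightarrow> 1" for i
  proof -
    have "(\<lambda>n. 1 - real i / real n) \<longlonglongrightarrow> 1 - 0"
      by (intro tendsto_diff tendsto_const lim_const_over_n)
    moreover have "\<forall>\<^sub>F n in sequentially. 1 - real i / real n = (real n - real i) / real n"
      using eventually_gt_at_top[of 0] by eventually_elim (simp add: field_simps)
    ultimately show ?thesis by (simp add: tendsto_cong)
  qed
  hence "(\<lambda>n. \<Prod>i=0..<k. (real n - real i) / real n) \<longlonglongrightarrow> (\<Prod>i=0..<k. 1)"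
    by (rule tendsto_prod)
  hence "(\<lambda>n. fact k / (\<Prod>i=0..<k. (real n - real i) / real n)) \<longlonglongrightarrow> fact k / (\<Prod>i=0..<k. 1)"
    by (intro tendsto_divide tendsto_const) auto
  \<comment> \<open>For n < k both sides are 0, since division by zero gives 0.\<close>
  moreover have "fact k / (\<Prod>i=0..<k. (real n - real i) / real n) = real n ^ k / real (n choose k)" for n
    by (simp add: binomial_gbinomial gbinomial_prod_rev prod_dividef)
  ultimately show ?thesis by simp
qed

text \<open>The estimate depends on \<open>N\<close> and not on the size of \<open>T\<close>, and so
  bounds a tail infimum. Replacing C(n, k) by n^k / k! is valid against a nonnegative factor, hence
  the case distinction; otherwise nonnegativity of the density suffices.\<close>

lemma density_caterpillar_lower:
  assumes d: "d \<ge> 2" and k: "k \<ge> 2" and T: "d_ary d T" and N: "N \<ge> k" "leaf_count T \<ge> N"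
  shows "fact k * (cat_coeff d k - 1 / (2 * real N)) \<le> density (caterpillar k) T"
proof (cases "cat_coeff d k \<le> 1 / (2 * real N)")
  case True
  hence "fact k * (cat_coeff d k - 1 / (2 * real N)) \<le> 0"
    by (intro mult_nonneg_nonpos) auto
  thus ?thesis using density_nonneg order_trans by blast
next
  case False
  define n where "n = leaf_count T"
  have n: "n \<ge> N" "n > 0" "k \<le> n" using N k by (auto simp: n_def)
  have "fact k * (cat_coeff d k - 1 / (2 * real N)) * real (n choose k) =
          real ((n choose k) * fact k) * (cat_coeff d k - 1 / (2 * real N))"
    by simp
  also have "\<dots> \<le> real (n ^ k) * (cat_coeff d k - 1 / (2 * real N))"
    by (intro mult_right_mono of_nat_mono binomial_fact_pow) (use False in auto)
  also have "\<dots> \<le> real (n ^ k) * (cat_coeff d k - 1 / (2 * real n))"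
    using n N k by (intro mult_left_mono diff_left_mono) (auto simp: frac_le)
  also have "\<dots> = cat_coeff d k * real n ^ k - real n ^ (k - 1) / 2"
    using n k by (cases k) (auto simp: field_simps)
  also have "\<dots> \<le> real (copies (caterpillar k) T)"
    unfolding n_def by (rule copies_caterpillar_lower[OF d k T])
  finally show ?thesis
    using n k by (simp add: density_def leaf_count_caterpillar pos_le_divide_eq flip: n_def)
qed

lemma bdd_below_density: "bdd_below (density D ` A)"
  by (rule bdd_belowI2[of _ 0]) (rule density_nonneg)

lemma liminf_density_antimono:
  assumes "C \<subseteq> C'" "\<And>N. \<exists>T\<in>C. N \<le> leaf_count T"
  shows "liminf_density C' D \<le> liminf_density C D"
proof (rule LIMSEQ_le)
  have "\<exists>T\<in>C'. N \<le> leaf_count T" for N using assms(1) assms(2)[of N] by blast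
  thus "tail_inf C' D \<longlonglongrightarrow> liminf_density C' D" by (rule tail_inf_LIMSEQ)
  show "tail_inf C D \<longlonglongrightarrow> liminf_density C D" by (rule tail_inf_LIMSEQ[OF assms(2)])
  have "tail_inf C' D n \<le> tail_inf C D n" for n
    unfolding tail_inf_def
  proof (intro cINF_superset_mono bdd_below_density)
    show "{T \<in> C. n \<le> leaf_count T} \<noteq> {}" using assms(2)[of n] by blast
    show "{T \<in> C. n \<le> leaf_count T} \<subseteq> {T \<in> C'. n \<le> leaf_count T}" using assms(1) by blast
  qed simp
  thus "\<exists>N. \<forall>n\<ge>N. tail_inf C' D n \<le> tail_inf C D n" by blast
qed

text \<open>Applied to two sequences \<open>b\<close>: the lower estimate tending to the claimed
  limit, and the constant minimum over trees with a given number of leaves.\<close>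

lemma liminf_density_ge:
  assumes "\<And>N. \<exists>T\<in>C. N \<le> leaf_count T" and "b \<longlonglongrightarrow> l"
    and "\<And>N T. N \<ge> M \<Longrightarrow> T \<in> C \<Longrightarrow> leaf_count T \<ge> N \<Longrightarrow> b N \<le> density D T"
  shows "l \<le> liminf_density C D"
proof (rule LIMSEQ_le[OF assms(2) tail_inf_LIMSEQ[OF assms(1)]])
  show "\<exists>N. \<forall>n\<ge>N. b n \<le> tail_inf C D n"
  proof (intro exI[of _ M] allI impI)
    fix n assume "n \<ge> M"
    thus "b n \<le> tail_inf C D n"
      unfolding tail_inf_def using assms(1)[of n] by (intro cINF_greatest assms(3)) auto
  qed
qed

text \<open>The complete tree of height \<open>h\<close> has d^h >= h leaves, so it bounds the tail
  infimum at the index \<open>h\<close> itself.\<close>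

lemma liminf_density_complete_tree_le:
  assumes d: "d \<ge> 2" and k: "k \<ge> 2" and C: "\<And>h. complete_tree d h \<in> C"
  shows "liminf_density C (caterpillar k) \<le> fact k * cat_coeff d k"
proof -
  have ge: "N \<le> leaf_count (complete_tree d N)" for N
    using d less_exp[of N] power_mono[of 2 d N] by (simp add: leaf_count_complete_tree)
  have "filterlim (\<lambda>h. d ^ h) at_top sequentially"
    by (rule filterlim_at_top_mono[OF filterlim_ident])
       (use d ge in \<open>simp add: leaf_count_complete_tree\<close>)
  hence "(\<lambda>h. real (d ^ h) ^ k / real (d ^ h choose k)) \<longlonglongrightarrow> fact k"
    by (rule filterlim_compose[OF power_over_binomial_LIMSEQ])
  hence lim: "(\<lambda>h. cat_coeff d k * (real (d ^ h) ^ k / real (d ^ h choose k))) \<longlonglongrightarrow> cat_coeff d k * fact k"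
    by (rule tendsto_mult_left)
  have "tail_inf C (caterpillar k) h \<le> cat_coeff d k * (real (d ^ h) ^ k / real (d ^ h choose k))" for h
  proof -
    have "tail_inf C (caterpillar k) h \<le> density (caterpillar k) (complete_tree d h)"
      unfolding tail_inf_def using C ge by (intro cINF_lower bdd_below_density) auto
    also have "\<dots> \<le> cat_coeff d k * real (d ^ h) ^ k / real (d ^ h choose k)"
      using d k copies_caterpillar_complete_tree[OF d k, of h]
      by (simp add: density_def leaf_count_complete_tree leaf_count_caterpillar divide_right_mono)
    finally show ?thesis by simp
  qed
  moreover have "tail_inf C (caterpillar k) \<longlonglongrightarrow> liminf_density C (caterpillar k)"
    using C ge by (intro tail_inf_LIMSEQ) blast
  ultimately have "liminf_density C (caterpillar k) \<le> cat_coeff d k * fact k"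
    by (intro LIMSEQ_le[OF _ lim]) auto
  thus ?thesis by (simp add: mult.commute)
qed

theorem theorem2:
  fixes d k :: nat
  assumes "d \<ge> 2" and "k \<ge> 2"
  shows "liminf_density {T. d_ary d T} (caterpillar k)
           = liminf_density {T. strictly_d_ary d T} (caterpillar k)
       \<and> liminf_density {T. strictly_d_ary d T} (caterpillar k)
           = fact k / 2 * (real d - 1) ^ (k - 1) * (\<Prod>j=1..k-1. inverse (real d ^ j - 1))
       \<and> (\<forall>n\<ge>k. Min (density (caterpillar k) ` {T. d_ary d T \<and> leaf_count T = n})
             \<le> liminf_density {T. d_ary d T} (caterpillar k))"
proof -
  let ?A = "{T. d_ary d T}" and ?S = "{T. strictly_d_ary d T}"
  have sub: "?S \<subseteq> ?A" by (auto simp: strictly_d_ary_def)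
  have S: "\<exists>T\<in>?S. N \<le> leaf_count T" for N
    using strictly_d_ary_unbounded[OF assms(1)] by blast
  hence A: "\<exists>T\<in>?A. N \<le> leaf_count T" for N using sub by blast
  have "(\<lambda>N. fact k * (cat_coeff d k - 1 / 2 / real N)) \<longlonglongrightarrow> fact k * (cat_coeff d k - 0)"
    by (intro tendsto_mult tendsto_diff tendsto_const lim_const_over_n)
  hence "(\<lambda>N. fact k * (cat_coeff d k - 1 / (2 * real N))) \<longlonglongrightarrow> fact k * cat_coeff d k"
    by simp
  hence "fact k * cat_coeff d k \<le> liminf_density ?A (caterpillar k)"
    by (rule liminf_density_ge[OF A, where M = k])
       (simp_all add: density_caterpillar_lower[OF assms])
  moreover have "liminf_density ?A (caterpillar k) \<le> liminf_density ?S (caterpillar k)"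
    by (rule liminf_density_antimono[OF sub S])
  moreover have "liminf_density ?S (caterpillar k) \<le> fact k * cat_coeff d k"
    using assms by (intro liminf_density_complete_tree_le) (auto intro: strictly_d_ary_complete_tree)
  \<comment> \<open>The inequalities run from the claimed value through both limits back to it, so
    equality holds throughout.\<close>
  ultimately have "liminf_density ?A (caterpillar k) = liminf_density ?S (caterpillar k)"
    "liminf_density ?S (caterpillar k) = fact k * cat_coeff d k" by linarith+
  \<comment> \<open>A constant lower bound from index \<open>n\<close> on: by leaf deletion, the
    minimum at \<open>n\<close> bounds the density of every tree with more leaves.\<close>
  moreover have "Min (density (caterpillar k) ` {T. d_ary d T \<and> leaf_count T = n})
      \<le> liminf_density ?A (caterpillar k)" if "n \<ge> k" for n
  proof (rule liminf_density_ge[OF A tendsto_const])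
    fix N T assume "n \<le> N" "T \<in> ?A" "N \<le> leaf_count T"
    thus "Min (density (caterpillar k) ` {T. d_ary d T \<and> leaf_count T = n}) \<le> density (caterpillar k) T"
      using Min_density_le[OF assms(2) that, of d T] by simp
  qed
  ultimately show ?thesis by (simp add: cat_coeff_def)
qed

end
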